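(* Let $x_0\in X$ be a Borwein properly efficient solution of NMFP, and let $s=(s_1,\dots,s_p)$ with $s_i=\frac{f_i(x_0)}{F_i(x_0)}$. Suppose that: (i) for all $i\in I$, $j\in J$, $k\in K$, the functions $f_i,F_i,g_j,h_k$ are locally Lipschitz continuous and regular in the sense of Clarke on $U$, and $f_i^{\circ\circ}(x;d)$, $g_j^{\circ\circ}(x;d)$, $h_k^{\circ\circ}(x;d)$ are finite for all $x\in U$ and all $d\in Z$; (ii) for all $i\in I$, $F_i$ is Gâteaux differentiable on $U$ with Gâteaux derivative $F'_{i,G}$, and $F_i''(x;d)$ exists for all $x\in U$ and all $d\in Z$; (iii) $f_i$ $(i\in I)$, $g_j$ $(j\in J)$ and $h_k$ $(k\in K)$ are Gâteaux differentiable at $x_0$, with Gâteaux derivatives $f'_{i,G}(x_0),g'_{j,G}(x_0),h'_{k,G}(x_0)$. If $C(Q,x_0)\subseteq T(X,x_0)$, then there exist $\lambda\in\mathbb{R}^p_{++}$, $\mu\in\mathbb{R}^m_+$ and $\nu\in\mathbb{R}^l$ such that $$\sum_{i=1}^p\lambda_i\big(f'_{i,G}(x_0)-s_iF'_{i,G}(x_0)\big)+\sum_{j=1}^m\mu_jg'_{j,G}(x_0)+\sum_{k=1}^l\nu_kh'_{k,G}(x_0)=0$$ and $\mu_jg_j(x_0)=0$ for $j=1,\dots,m$.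
   Context: Setting. $Z$ is a real reflexive Banach space with dual $Z^*$ and pairing $\langle\cdot,\cdot\rangle$; $U\subseteq Z$ is nonempty and open; $f,F:Z\to\mathbb{R}^p$, $g:Z\to\mathbb{R}^m$, $h:Z\to\mathbb{R}^l$ have components $f_i,F_i$ ($i\in I=\{1,\dots,p\}$), $g_j$ ($j\in J=\{1,\dots,m\}$), $h_k$ ($k\in K=\{1,\dots,l\}$), and $F_i(x)>0$ for all $x\in U$, $i\in I$. $\frac fF=(\frac{f_1}{F_1},\dots,\frac{f_p}{F_p})^\top$ on $U$. NMFP is the problem of minimizing $\frac{f}{F}$ over $X=\{x\in U: g_j(x)\le0\ \forall j\in J,\ h_k(x)=0\ \forall k\in K\}$. $\mathbb{R}^n_+$ and $\mathbb{R}^n_{++}$ are the nonnegative and positive orthants. Derivatives. For $\vartheta:U\to\mathbb{R}$, $x\in U$, $v\in Z$: $\vartheta'(x;v)=\lim_{t\to0^+}\frac{\vartheta(x+tv)-\vartheta(x)}{t}$; $\vartheta$ is Gâteaux differentiable at $x$ with Gâteaux derivative $\vartheta'_G(x)\in Z^*$ if $\vartheta'(x;v)$ exists and equals $\langle\vartheta'_G(x),v\rangle$ for all $v\in Z$; $\vartheta^{\circ}(x;v)=\limsup_{y\to x,\,t\to0^+}\frac{\vartheta(y+tv)-\vartheta(y)}{t}$ (Clarke); $\vartheta$ is regular in the sense of Clarke at $x$ if $\vartheta'(x;v)$ exists and equals $\vartheta^\circ(x;v)$ for all $v\in Z$; $\vartheta''(x;v)=\lim_{t\to0^+}\frac{\vartheta(x+tv)-\vartheta(x)-t\vartheta'(x;v)}{\frac12t^2}$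 if the limit exists; $\vartheta^{\circ\circ}(x;v)=\limsup_{t\to0^+}\frac{\vartheta(x+tv)-\vartheta(x)-t\vartheta^\circ(x;v)}{\frac12t^2}$ (Páles–Zeidan). Cones. For a subset $A$ of a normed space $Y$ and $a\in A$, the contingent cone is $T(A,a)=\{d\in Y:\exists\,t_k\to0^+,\ d_k\to d,\ a+t_kd_k\in A\ \forall k\}$. For $x_0\in X$: $J(x_0)=\{j\in J:g_j(x_0)=0\}$, and the linearizing cone is $$C(Q,x_0)=\{d\in Z:\ (\tfrac{f_i}{F_i})^\circ(x_0;d)\le0\ \forall i\in I,\ g_j^\circ(x_0;d)\le0\ \forall j\in J(x_0),\ h_k^\circ(x_0;d)=0\ \forall k\in K\}$$ (here $Q$ is only part of the notation). Borwein properly efficient solution. $x_0\in X$ is a Borwein properly efficient solution of NMFP if $T\big((\frac fF)(X)+\mathbb{R}^p_+,\ (\frac fF)(x_0)\big)\cap(-\mathbb{R}^p_+)=\{0\}$. *)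

theory Defs
  imports "HOL-Analysis.Analysis"
begin

section \<open>Reflexive spaces and orthants\<close>

text \<open>The dual of a real normed space \<open>'a\<close> is the type \<open>'a \<Rightarrow>\<^sub>L real\<close>.\<close>

definition reflexive_space :: "'a::real_normed_vector itself \<Rightarrow> bool" where
  "reflexive_space _ \<longleftrightarrow>
     (\<forall>\<Phi> :: ('a \<Rightarrow>\<^sub>L real) \<Rightarrow>\<^sub>L real. \<exists>z::'a. \<forall>\<phi>. blinfun_apply \<Phi> \<phi> = blinfun_apply \<phi> z)"

definition nonneg_orthant :: "(real ^ 'n) set" where
  "nonneg_orthant = {y. \<forall>i. 0 \<le> y $ i}"

definition pos_orthant :: "(real ^ 'n) set" where
  "pos_orthant = {y. \<forall>i. 0 < y $ i}"

section \<open>Generalized derivatives\<close>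

text \<open>Functions on an open set \<open>U\<close> are total functions here. All notions below are evaluated only
  at points of \<open>U\<close>, where they depend only on the values of the function near the point.\<close>

definition locally_lipschitz_on :: "'a::metric_space set \<Rightarrow> ('a \<Rightarrow> real) \<Rightarrow> bool" where
  "locally_lipschitz_on U \<theta> \<longleftrightarrow>
     (\<forall>x\<in>U. \<exists>\<epsilon>>0. \<exists>L. L-lipschitz_on (ball x \<epsilon> \<inter> U) \<theta>)"

definition has_dir_deriv ::
    "('a::real_normed_vector \<Rightarrow> real) \<Rightarrow> 'a \<Rightarrow> 'a \<Rightarrow> real \<Rightarrow> bool" where
  "has_dir_deriv \<theta> x v c \<longleftrightarrow> ((\<lambda>t. (\<theta> (x + t *\<^sub>R v) - \<theta> x) / t) \<longlongrightarrow> c) (at_right 0)"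

definition has_gateaux_deriv ::
    "('a::real_normed_vector \<Rightarrow> real) \<Rightarrow> 'a \<Rightarrow> ('a \<Rightarrow>\<^sub>L real) \<Rightarrow> bool" where
  "has_gateaux_deriv \<theta> x \<phi> \<longleftrightarrow> (\<forall>v. has_dir_deriv \<theta> x v (blinfun_apply \<phi> v))"

text \<open>The upper limit over \<open>y \<rightarrow> x\<close> admits \<open>y = x\<close>, hence \<open>nhds x\<close> and not \<open>at x\<close>. Upper limits are
  extended-real-valued.\<close>

definition clarke_deriv ::
    "('a::real_normed_vector \<Rightarrow> real) \<Rightarrow> 'a \<Rightarrow> 'a \<Rightarrow> ereal" where
  "clarke_deriv \<theta> x v =
     Limsup (nhds x \<times>\<^sub>F at_right (0::real)) (\<lambda>(y, t). ereal ((\<theta> (y + t *\<^sub>R v) - \<theta> y) / t))"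

definition clarke_regular :: "('a::real_normed_vector \<Rightarrow> real) \<Rightarrow> 'a \<Rightarrow> bool" where
  "clarke_regular \<theta> x \<longleftrightarrow> (\<forall>v. \<exists>c. has_dir_deriv \<theta> x v c \<and> clarke_deriv \<theta> x v = ereal c)"

definition has_second_dir_deriv ::
    "('a::real_normed_vector \<Rightarrow> real) \<Rightarrow> 'a \<Rightarrow> 'a \<Rightarrow> real \<Rightarrow> bool" where
  "has_second_dir_deriv \<theta> x v c \<longleftrightarrow>
     (\<exists>b. has_dir_deriv \<theta> x v b \<and>
          ((\<lambda>t. (\<theta> (x + t *\<^sub>R v) - \<theta> x - t * b) / (t\<^sup>2 / 2)) \<longlongrightarrow> c) (at_right 0))"

text \<open>The second-order upper derivative of Pales and Zeidan.\<close>

definition pales_zeidan_deriv ::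
    "('a::real_normed_vector \<Rightarrow> real) \<Rightarrow> 'a \<Rightarrow> 'a \<Rightarrow> ereal" where
  "pales_zeidan_deriv \<theta> x v =
     Limsup (at_right (0::real))
       (\<lambda>t. (ereal (\<theta> (x + t *\<^sub>R v) - \<theta> x) - ereal t * clarke_deriv \<theta> x v) / ereal (t\<^sup>2 / 2))"

section \<open>Cones and the fractional problem\<close>

definition contingent_cone :: "'a::real_normed_vector set \<Rightarrow> 'a \<Rightarrow> 'a set" where
  "contingent_cone A a =
     {d. \<exists>(t :: nat \<Rightarrow> real) (e :: nat \<Rightarrow> 'a).
           (\<forall>k. 0 < t k) \<and> t \<longlonglongrightarrow> 0 \<and> e \<longlonglongrightarrow> d \<and> (\<forall>k. a + t k *\<^sub>R e k \<in> A)}"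

text \<open>The objectives take values in \<open>real ^ 'p\<close>; the constraints are families indexed by
  \<open>{1..m}\<close> and \<open>{1..l}\<close>, so that either kind of constraint may be absent.\<close>

definition feasible_set ::
    "'a set \<Rightarrow> nat \<Rightarrow> (nat \<Rightarrow> 'a \<Rightarrow> real) \<Rightarrow> nat \<Rightarrow> (nat \<Rightarrow> 'a \<Rightarrow> real) \<Rightarrow> 'a set" where
  "feasible_set U m g l h = {x\<in>U. (\<forall>j\<in>{1..m}. g j x \<le> 0) \<and> (\<forall>k\<in>{1..l}. h k x = 0)}"

definition vec_quotient :: "('a \<Rightarrow> real ^ 'p) \<Rightarrow> ('a \<Rightarrow> real ^ 'p) \<Rightarrow> 'a \<Rightarrow> real ^ 'p" where
  "vec_quotient f F x = (\<chi> i. f x $ i / F x $ i)"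

definition active_set :: "nat \<Rightarrow> (nat \<Rightarrow> 'a \<Rightarrow> real) \<Rightarrow> 'a \<Rightarrow> nat set" where
  "active_set m g x0 = {j\<in>{1..m}. g j x0 = 0}"

definition linearizing_cone ::
    "('a::real_normed_vector \<Rightarrow> real ^ 'p) \<Rightarrow> ('a \<Rightarrow> real ^ 'p) \<Rightarrow>
     nat \<Rightarrow> (nat \<Rightarrow> 'a \<Rightarrow> real) \<Rightarrow> nat \<Rightarrow> (nat \<Rightarrow> 'a \<Rightarrow> real) \<Rightarrow> 'a \<Rightarrow> 'a set" where
  "linearizing_cone f F m g l h x0 =
     {d. (\<forall>i. clarke_deriv (\<lambda>x. vec_quotient f F x $ i) x0 d \<le> 0) \<and>
         (\<forall>j\<in>active_set m g x0. clarke_deriv (g j) x0 d \<le> 0) \<and>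
         (\<forall>k\<in>{1..l}. clarke_deriv (h k) x0 d = 0)}"

definition borwein_properly_efficient ::
    "('a \<Rightarrow> real ^ 'p) \<Rightarrow> 'a set \<Rightarrow> 'a \<Rightarrow> bool" where
  "borwein_properly_efficient q X x0 \<longleftrightarrow>
     x0 \<in> X \<and>
     contingent_cone {q x + r | x r. x \<in> X \<and> r \<in> nonneg_orthant} (q x0)
       \<inter> uminus ` nonneg_orthant = {0}"

end

(* At x0 a Gateaux differentiable Clarke regular function is strictly differentiable in every
   direction, and so is each quotient f_i / F_i, with derivative (f_i' - s_i F_i') / F_i(x0). The
   linearizing cone is thus cut out by finitely many continuous linear functionals. A direction in
   it is contingent to X, and the derivative of f / F maps it into the contingent cone of the image
   set and into minus the orthant. By Borwein efficiency this derivative vanishes. Hence the sum of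
   the -a_i is <= 0 on the cone, where a_i = f_i' - s_i F_i'; Farkas' lemma writes it as a combination
   of the functionals, and moving it across gives each a_i a multiplier of at least 1. *)
theory Submission
  imports Defs
begin

section \<open>Farkas' lemma for linear functionals\<close>

(* Bartl's algebraic proof: if the implication fails without the constraint k, at z say, project
   along z onto the kernel of a k. *)
lemma farkas:
  fixes a :: "'i \<Rightarrow> 'a::real_vector \<Rightarrow> real"
  assumes "finite I" "\<And>i. i \<in> I \<Longrightarrow> linear (a i)" "linear b"
    and "\<And>x. (\<And>i. i \<in> I \<Longrightarrow> a i x \<le> 0) \<Longrightarrow> b x \<le> 0"
  shows "\<exists>c. (\<forall>i\<in>I. 0 \<le> c i) \<and> (\<forall>x. b x = (\<Sum>i\<in>I. c i * a i x))"
  using assms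
proof (induction I arbitrary: a b rule: finite_induct)
  case empty
  \<comment> \<open>With no constraints the hypothesis applies to both \<open>x\<close> and
    \<open>- x\<close>.\<close>
  have "b x = 0" for x
    using empty.prems(3)[of x] empty.prems(3)[of "- x"] linear_neg[OF empty.prems(2), of x] by simp
  then show ?case by simp
next
  case (insert k I)
  show ?case
  proof (cases "\<forall>x. (\<forall>i\<in>I. a i x \<le> 0) \<longrightarrow> b x \<le> 0")
    case True
    with insert.IH[of a b] insert.prems obtain c
      where c: "\<forall>i\<in>I. 0 \<le> c i" "\<forall>x. b x = (\<Sum>i\<in>I. c i * a i x)" by auto
    \<comment> \<open>Here constraint \<open>k\<close> is redundant, so it receives the multiplier
      0; resetting \<open>c\<close> at \<open>k\<close> leaves the sum over \<open>I\<close> alone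
      because \<open>k\<close> is not in \<open>I\<close>.\<close>
    have eq: "(\<Sum>i\<in>I. (c(k := 0)) i * a i x) = (\<Sum>i\<in>I. c i * a i x)" for x
      using insert.hyps by (intro sum.cong) auto
    show ?thesis
      using c insert.hyps eq by (intro exI[of _ "c(k := 0)"]) auto
  next
    case False
    then obtain z where z: "\<And>i. i \<in> I \<Longrightarrow> a i z \<le> 0" "b z > 0" by force
    have lin_k: "linear (a k)" and lin: "\<And>i. i \<in> I \<Longrightarrow> linear (a i)" and lin_b: "linear b"
      using insert.prems by auto
    \<comment> \<open>Otherwise \<open>z\<close> would satisfy every constraint, which would force
      \<open>b z \<le> 0\<close>.\<close>
    have kz: "a k z > 0"
      using insert.prems(3)[of z] z by force
    define P where "P x = x - (a k x / a k z) *\<^sub>R z" for x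
    have P: "l (P x) = l x - a k x / a k z * l z" if "linear l" for l :: "'a \<Rightarrow> real" and x
      using that by (simp add: P_def linear_diff linear_scale)
    have linP: "linear (\<lambda>x. l (P x))" if "linear l" for l :: "'a \<Rightarrow> real"
      unfolding P[OF that]
      by (rule linearI)
        (simp_all add: linear_add[OF that] linear_add[OF lin_k] linear_scale[OF that]
          linear_scale[OF lin_k] algebra_simps add_divide_distrib)
    have kP: "a k (P x) = 0" for x
      using kz by (simp add: P[OF lin_k])
    \<comment> \<open>The induction hypothesis is used for the functionals composed with
      \<open>P\<close>. Constraint \<open>k\<close> holds with equality at every \<open>P x\<close>,
      so the remaining ones suffice for \<open>b (P x) \<le> 0\<close>.\<close>
    have "\<exists>c. (\<forall>i\<in>I. 0 \<le> c i) \<and> (\<forall>x. b (P x) = (\<Sum>i\<in>I. c i * a i (P x)))"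
    proof (rule insert.IH)
      show "linear (\<lambda>x. a i (P x))" if "i \<in> I" for i
        using linP lin that by blast
      show "b (P x) \<le> 0" if "\<And>i. i \<in> I \<Longrightarrow> a i (P x) \<le> 0" for x
        by (rule insert.prems(3)) (use that kP in auto)
    qed (use linP lin_b in blast)
    then obtain c where c: "\<forall>i\<in>I. 0 \<le> c i"
      and bP: "\<forall>x. b (P x) = (\<Sum>i\<in>I. c i * a i (P x))" by blast
    \<comment> \<open>Expanding \<open>P\<close> in the identity for \<open>b (P x)\<close> leaves
      exactly this coefficient in front of \<open>a k x\<close>. It is nonnegative since
      \<open>b z > 0\<close> while each \<open>a i z \<le> 0\<close>.\<close>
    define r where "r = (b z - (\<Sum>i\<in>I. c i * a i z)) / a k z"
    have "(\<Sum>i\<in>I. c i * a i z) \<le> 0"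
      using c z by (intro sum_nonpos) (auto intro: mult_nonneg_nonpos)
    then have r: "0 \<le> r"
      using z kz by (simp add: r_def)
    have bx: "b x = r * a k x + (\<Sum>i\<in>I. c i * a i x)" for x
    proof -
      have "(\<Sum>i\<in>I. c i * a i (P x)) = (\<Sum>i\<in>I. c i * a i x - a k x / a k z * (c i * a i z))"
        using P[OF lin] by (intro sum.cong) (simp_all add: right_diff_distrib)
      also have "\<dots> = (\<Sum>i\<in>I. c i * a i x) - a k x / a k z * (\<Sum>i\<in>I. c i * a i z)"
        by (simp add: sum_subtractf sum_distrib_left)
      finally have "b x - a k x / a k z * b z
          = (\<Sum>i\<in>I. c i * a i x) - a k x / a k z * (\<Sum>i\<in>I. c i * a i z)"
        using bP P[OF lin_b, of x] by simp
      then show ?thesis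
        using kz by (simp add: r_def field_simps)
    qed
    have eq: "(\<Sum>i\<in>I. (c(k := r)) i * a i x) = (\<Sum>i\<in>I. c i * a i x)" for x
      using insert.hyps by (intro sum.cong) auto
    show ?thesis
      using c r bx insert.hyps eq by (intro exI[of _ "c(k := r)"]) auto
  qed
qed

text \<open>Each equation is split into two opposite inequalities; the difference of their two
  nonnegative multipliers is a multiplier of arbitrary sign.\<close>

lemma farkas_equality:
  fixes a :: "'i \<Rightarrow> 'a::real_vector \<Rightarrow> real" and e :: "'k \<Rightarrow> 'a \<Rightarrow> real"
  assumes fin: "finite I" "finite K"
    and lin: "\<And>i. i \<in> I \<Longrightarrow> linear (a i)" "\<And>k. k \<in> K \<Longrightarrow> linear (e k)" "linear b"
    and imp: "\<And>x. (\<And>i. i \<in> I \<Longrightarrow> a i x \<le> 0) \<Longrightarrow> (\<And>k. k \<in> K \<Longrightarrow> e k x = 0) \<Longrightarrow> b x \<le> 0"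
  shows "\<exists>c d. (\<forall>i\<in>I. 0 \<le> c i) \<and> (\<forall>x. b x = (\<Sum>i\<in>I. c i * a i x) + (\<Sum>k\<in>K. d k * e k x))"
proof -
  \<comment> \<open>The three summands of the index type carry \<open>a\<close>, \<open>e\<close>
    and the negatives of \<open>e\<close>.\<close>
  define A where "A = case_sum a (case_sum e (\<lambda>k x. - e k x))"
  have "\<exists>c. (\<forall>i \<in> I <+> (K <+> K). 0 \<le> c i) \<and> (\<forall>x. b x = (\<Sum>i \<in> I <+> (K <+> K). c i * A i x))"
  proof (rule farkas)
    show "linear (A i)" if "i \<in> I <+> (K <+> K)" for i
      using that lin by (auto simp: A_def linear_compose_neg)
    show "b x \<le> 0" if x: "\<And>i. i \<in> I <+> (K <+> K) \<Longrightarrow> A i x \<le> 0" for x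
    proof (rule imp)
      show "a i x \<le> 0" if "i \<in> I" for i
        using x[of "Inl i"] that by (simp add: A_def InlI)
      show "e k x = 0" if "k \<in> K" for k
        using x[of "Inr (Inl k)"] x[of "Inr (Inr k)"] that by (simp add: A_def InlI InrI)
    qed
  qed (use fin lin in auto)
  then obtain c where c: "\<forall>i \<in> I <+> (K <+> K). 0 \<le> c i"
    and b: "\<forall>x. b x = (\<Sum>i \<in> I <+> (K <+> K). c i * A i x)" by blast
  have "b x = (\<Sum>i\<in>I. c (Inl i) * a i x)
      + (\<Sum>k\<in>K. (c (Inr (Inl k)) - c (Inr (Inr k))) * e k x)" for x
    using fin by (simp add: b[rule_format] sum.Plus A_def left_diff_distrib sum_subtractf sum_negf)
  then show ?thesis
    using c by (intro exI[of _ "\<lambda>i. c (Inl i)"] exI[of _ "\<lambda>k. c (Inr (Inl k)) - c (Inr (Inr k))"])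
      auto
qed

text \<open>Strict positivity of all \<open>c i\<close> at once comes from applying Farkas' lemma to
  the negated sum of the \<open>a i\<close>: by \<open>zero\<close> this sum vanishes wherever the
  constraints hold, so it is in particular nonpositive there.\<close>

lemma tucker_alternative:
  fixes a :: "'i \<Rightarrow> 'a::real_vector \<Rightarrow> real" and g :: "'j \<Rightarrow> 'a \<Rightarrow> real" and e :: "'k \<Rightarrow> 'a \<Rightarrow> real"
  assumes fin: "finite I" "finite J" "finite K"
    and lin: "\<And>i. i \<in> I \<Longrightarrow> linear (a i)" "\<And>j. j \<in> J \<Longrightarrow> linear (g j)"
      "\<And>k. k \<in> K \<Longrightarrow> linear (e k)"
    and zero: "\<And>x i. (\<And>i. i \<in> I \<Longrightarrow> a i x \<le> 0) \<Longrightarrow> (\<And>j. j \<in> J \<Longrightarrow> g j x \<le> 0) \<Longrightarrow>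
      (\<And>k. k \<in> K \<Longrightarrow> e k x = 0) \<Longrightarrow> i \<in> I \<Longrightarrow> a i x = 0"
  shows "\<exists>c u v. (\<forall>i\<in>I. 0 < c i) \<and> (\<forall>j\<in>J. 0 \<le> u j) \<and>
    (\<forall>x. (\<Sum>i\<in>I. c i * a i x) + (\<Sum>j\<in>J. u j * g j x) + (\<Sum>k\<in>K. v k * e k x) = 0)"
proof -
  define A where "A = case_sum a g"
  have linA: "linear (A i)" if "i \<in> I <+> J" for i
    using that lin by (auto simp: A_def)
  have "\<exists>c v. (\<forall>i \<in> I <+> J. 0 \<le> c i) \<and>
      (\<forall>x. - (\<Sum>i\<in>I. a i x) = (\<Sum>i \<in> I <+> J. c i * A i x) + (\<Sum>k\<in>K. v k * e k x))"
  proof (rule farkas_equality)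
    show "linear (\<lambda>x. - (\<Sum>i\<in>I. a i x))"
      using lin by (intro linear_compose_neg linear_compose_sum) auto
    show "- (\<Sum>i\<in>I. a i x) \<le> 0"
      if x: "\<And>i. i \<in> I <+> J \<Longrightarrow> A i x \<le> 0" "\<And>k. k \<in> K \<Longrightarrow> e k x = 0" for x
    proof -
      have "a i x = 0" if "i \<in> I" for i
      proof (rule zero)
        show "a i x \<le> 0" if "i \<in> I" for i
          using x(1)[of "Inl i"] that by (simp add: A_def InlI)
        show "g j x \<le> 0" if "j \<in> J" for j
          using x(1)[of "Inr j"] that by (simp add: A_def InrI)
      qed (use x that in auto)
      then show ?thesis by simp
    qed
  qed (use fin lin linA in auto)
  then obtain c v where c: "\<forall>i \<in> I <+> J. 0 \<le> c i"
    and eq: "\<forall>x. - (\<Sum>i\<in>I. a i x) = (\<Sum>i \<in> I <+> J. c i * A i x) + (\<Sum>k\<in>K. v k * e k x)"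
    by blast
  \<comment> \<open>Moving the negated sum across adds 1 to each nonnegative multiplier of the
    \<open>a i\<close>, which makes it positive.\<close>
  have "(\<Sum>i\<in>I. (1 + c (Inl i)) * a i x) + (\<Sum>j\<in>J. c (Inr j) * g j x) + (\<Sum>k\<in>K. v k * e k x) = 0"
    for x
    using eq[rule_format, of x] fin by (simp add: sum.Plus A_def distrib_right sum.distrib)
  moreover have "0 < 1 + c (Inl i)" if "i \<in> I" for i
    using c[rule_format, of "Inl i"] that by (simp add: InlI add_pos_nonneg)
  ultimately show ?thesis
    using c by (intro exI[of _ "\<lambda>i. 1 + c (Inl i)"] exI[of _ "\<lambda>j. c (Inr j)"] exI[of _ v]) auto
qed

section \<open>Directional derivatives\<close>

lemma has_dir_deriv_unique: "has_dir_deriv \<theta> x v b \<Longrightarrow> has_dir_deriv \<theta> x v c \<Longrightarrow> b = c"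
  unfolding has_dir_deriv_def by (rule tendsto_unique[rotated]) auto

lemma clarke_deriv_gateaux:
  assumes "clarke_regular \<theta> x" "has_gateaux_deriv \<theta> x \<phi>"
  shows "clarke_deriv \<theta> x v = ereal (blinfun_apply \<phi> v)"
  using assms has_dir_deriv_unique unfolding clarke_regular_def has_gateaux_deriv_def by metis

lemma filterlim_shift_base:
  fixes x v :: "'a::real_normed_vector"
  shows "filterlim (\<lambda>(y, t). y + t *\<^sub>R v) (nhds x) (nhds x \<times>\<^sub>F at_right (0::real))"
proof -
  have "filterlim fst (nhds x) (nhds x \<times>\<^sub>F at_right (0::real))"
    by (rule filterlim_fst)
  moreover have "filterlim snd (nhds 0) (nhds x \<times>\<^sub>F at_right (0::real))"
    by (rule filterlim_mono[OF filterlim_snd at_within_le_nhds order_refl])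
  ultimately have "((\<lambda>p. fst p + snd p *\<^sub>R v) \<longlongrightarrow> x + 0 *\<^sub>R v) (nhds x \<times>\<^sub>F at_right (0::real))"
    by (intro tendsto_intros)
  then show ?thesis by (simp add: case_prod_unfold)
qed

(* The lower bound comes from the Clarke derivative in the direction -v, with base point y + t v. *)
lemma clarke_regular_strict_deriv:
  assumes reg: "clarke_regular \<theta> x" and gat: "has_gateaux_deriv \<theta> x \<phi>"
  shows "((\<lambda>(y, t). (\<theta> (y + t *\<^sub>R v) - \<theta> y) / t) \<longlongrightarrow> blinfun_apply \<phi> v) (nhds x \<times>\<^sub>F at_right 0)"
proof -
  have upper: "\<forall>\<^sub>F (y, t) in nhds x \<times>\<^sub>F at_right 0. (\<theta> (y + t *\<^sub>R w) - \<theta> y) / t < C"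
    if "blinfun_apply \<phi> w < C" for w C
  proof -
    have "clarke_deriv \<theta> x w < ereal C"
      using that by (simp add: clarke_deriv_gateaux[OF reg gat])
    from Limsup_lessD[OF this[unfolded clarke_deriv_def]] show ?thesis
      by (simp add: case_prod_unfold)
  qed
  \<comment> \<open>This change of base point preserves the filter, so an eventual bound at
    \<open>(y, t)\<close> also holds at the shifted pair. The quotient there in direction
    \<open>- v\<close> is the negative of the quotient at \<open>y\<close> in direction
    \<open>v\<close>.\<close>
  have shift: "filterlim (\<lambda>(y, t). (y + t *\<^sub>R v, t)) (nhds x \<times>\<^sub>F at_right 0) (nhds x \<times>\<^sub>F at_right (0::real))"
    using filterlim_Pair[OF filterlim_shift_base[of v x] filterlim_snd] by (simp add: case_prod_unfold)
  show ?thesis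
  proof (rule order_tendstoI)
    fix C assume "C < blinfun_apply \<phi> v"
    then have "blinfun_apply \<phi> (- v) < - C" by (simp add: blinfun.minus_right)
    from filterlim_iff[THEN iffD1, OF shift, rule_format, OF upper[OF this]]
    show "\<forall>\<^sub>F p in nhds x \<times>\<^sub>F at_right 0. C < (case p of (y, t) \<Rightarrow> (\<theta> (y + t *\<^sub>R v) - \<theta> y) / t)"
    proof (rule eventually_mono)
      fix p :: "'a \<times> real"
      obtain y t where p: "p = (y, t)" by (cases p)
      have "(\<theta> y - \<theta> (y + t *\<^sub>R v)) / t = - ((\<theta> (y + t *\<^sub>R v) - \<theta> y) / t)"
        by (metis minus_diff_eq minus_divide_left)
      moreover assume "case (case p of (y, t) \<Rightarrow> (y + t *\<^sub>R v, t)) of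
        (y, t) \<Rightarrow> (\<theta> (y + t *\<^sub>R - v) - \<theta> y) / t < - C"
      ultimately show "C < (case p of (y, t) \<Rightarrow> (\<theta> (y + t *\<^sub>R v) - \<theta> y) / t)"
        by (simp add: p)
    qed
  next
    fix C assume "blinfun_apply \<phi> v < C"
    from upper[OF this]
    show "\<forall>\<^sub>F p in nhds x \<times>\<^sub>F at_right 0. (case p of (y, t) \<Rightarrow> (\<theta> (y + t *\<^sub>R v) - \<theta> y) / t) < C"
      by (simp add: case_prod_unfold)
  qed
qed

text \<open>A limit over a nontrivial filter is also the upper limit. This computes the Clarke
  derivative of the quotients, whose regularity is not among the assumptions.\<close>

lemma clarke_deriv_strict:
  assumes "((\<lambda>(y, t). (\<theta> (y + t *\<^sub>R v) - \<theta> y) / t) \<longlongrightarrow> c) (nhds x \<times>\<^sub>F at_right 0)"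
  shows "clarke_deriv \<theta> x v = ereal c"
  unfolding clarke_deriv_def
proof (rule lim_imp_Limsup)
  show "nhds x \<times>\<^sub>F at_right (0::real) \<noteq> bot"
    by (simp add: prod_filter_eq_bot trivial_limit_at_right_real)
  show "((\<lambda>(y, t). ereal ((\<theta> (y + t *\<^sub>R v) - \<theta> y) / t)) \<longlongrightarrow> ereal c) (nhds x \<times>\<^sub>F at_right 0)"
    using tendsto_ereal[OF assms] by (simp add: case_prod_unfold)
qed

section \<open>Limits for locally Lipschitz functions and quotients\<close>

lemma locally_lipschitz_onD:
  assumes "locally_lipschitz_on U \<theta>" "open U" "x \<in> U"
  obtains \<epsilon> L where "0 < \<epsilon>" "L-lipschitz_on (ball x \<epsilon>) \<theta>"
proof -
  obtain \<epsilon> L where \<epsilon>: "0 < \<epsilon>" "L-lipschitz_on (ball x \<epsilon> \<inter> U) \<theta>"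
    using assms unfolding locally_lipschitz_on_def by blast
  obtain \<delta> where \<delta>: "0 < \<delta>" "ball x \<delta> \<subseteq> U"
    using assms openE by blast
  have "ball x (min \<epsilon> \<delta>) \<subseteq> ball x \<epsilon> \<inter> U"
    using \<delta> by auto
  then show thesis
    using that[of "min \<epsilon> \<delta>" L] \<epsilon>(1) \<delta>(1) lipschitz_on_subset[OF \<epsilon>(2)] by auto
qed

lemma locally_lipschitz_on_tendsto:
  assumes "locally_lipschitz_on U \<theta>" "open U" "x \<in> U" and u: "(u \<longlongrightarrow> x) G"
  shows "((\<lambda>n. \<theta> (u n)) \<longlongrightarrow> \<theta> x) G"
proof -
  obtain \<epsilon> L where "0 < \<epsilon>" "L-lipschitz_on (ball x \<epsilon>) \<theta>"
    using locally_lipschitz_onD[OF assms(1-3)] .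
  then have "isCont \<theta> x"
    by (metis continuous_on_eq_continuous_at lipschitz_on_continuous_on open_ball centre_in_ball)
  then show ?thesis
    using u by (rule isCont_tendsto_compose)
qed

text \<open>The contingent cone supplies directions \<open>e k\<close> that vary with
  \<open>k\<close>. Replacing \<open>e k\<close> by its limit \<open>d\<close> changes the
  difference quotient by at most \<open>L * norm (e k - d)\<close>, which tends to 0.\<close>

lemma locally_lipschitz_on_hadamard_deriv:
  fixes \<theta> :: "'a::real_normed_vector \<Rightarrow> real"
  assumes lip: "locally_lipschitz_on U \<theta>" "open U" "x \<in> U"
    and deriv: "has_dir_deriv \<theta> x d c"
    and t: "\<And>k. 0 < t k" "t \<longlonglongrightarrow> 0" and e: "e \<longlonglongrightarrow> d"
  shows "(\<lambda>k. (\<theta> (x + t k *\<^sub>R e k) - \<theta> x) / t k) \<longlonglongrightarrow> c"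
proof -
  obtain \<epsilon> L where "0 < \<epsilon>" and L: "L-lipschitz_on (ball x \<epsilon>) \<theta>"
    using locally_lipschitz_onD[OF lip] .
  have "filterlim t (at_right 0) sequentially"
    using t by (auto simp: filterlim_at less_imp_neq[symmetric])
  then have along: "(\<lambda>k. (\<theta> (x + t k *\<^sub>R d) - \<theta> x) / t k) \<longlonglongrightarrow> c"
    using deriv unfolding has_dir_deriv_def by (rule filterlim_compose[rotated])
  \<comment> \<open>Needed for \<open>e\<close> and for the constant sequence \<open>d\<close>,
    since the Lipschitz bound compares two points of the ball.\<close>
  have near: "\<forall>\<^sub>F k in sequentially. x + t k *\<^sub>R w k \<in> ball x \<epsilon>" if "w \<longlonglongrightarrow> d" for w
  proof -
    have "(\<lambda>k. x + t k *\<^sub>R w k) \<longlonglongrightarrow> x + 0 *\<^sub>R d"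
      using t that by (intro tendsto_intros)
    then show ?thesis
      using \<open>0 < \<epsilon>\<close> by (intro topological_tendstoD[where l = x]) auto
  qed
  have "(\<lambda>k. (\<theta> (x + t k *\<^sub>R e k) - \<theta> (x + t k *\<^sub>R d)) / t k) \<longlonglongrightarrow> 0"
  proof (rule Lim_null_comparison)
    show "\<forall>\<^sub>F k in sequentially.
        norm ((\<theta> (x + t k *\<^sub>R e k) - \<theta> (x + t k *\<^sub>R d)) / t k) \<le> L * norm (e k - d)"
      using near[OF e] near[OF tendsto_const]
    proof eventually_elim
      case (elim k)
      have "dist (x + t k *\<^sub>R e k) (x + t k *\<^sub>R d) = t k * norm (e k - d)"
        using t(1)[of k] by (simp add: dist_norm flip: scaleR_diff_right)
      then have "\<bar>\<theta> (x + t k *\<^sub>R e k) - \<theta> (x + t k *\<^sub>R d)\<bar> \<le> L * (t k * norm (e k - d))"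
        using lipschitz_onD[OF L elim] by (simp add: dist_real_def)
      then show ?case
        using t(1)[of k] by (simp add: field_simps)
    qed
    show "(\<lambda>k. L * norm (e k - d)) \<longlonglongrightarrow> 0"
      using tendsto_mult_right_zero[OF tendsto_norm_zero[OF LIM_zero[OF e]]] .
  qed
  from tendsto_add[OF this along] show ?thesis
    by (simp add: diff_divide_distrib)
qed

text \<open>A quotient rule in which both endpoints may move: it covers the strict derivative, where
  the base point varies, and difference quotients along a sequence with fixed base point.\<close>

lemma tendsto_difference_quotient_divide:
  fixes p p' q q' t :: "'b \<Rightarrow> real"
  assumes "(p \<longlongrightarrow> a) G" "(p' \<longlongrightarrow> a) G" "(q \<longlongrightarrow> b) G" "(q' \<longlongrightarrow> b) G" "b \<noteq> 0"
    and "((\<lambda>n. (p n - p' n) / t n) \<longlongrightarrow> A) G" "((\<lambda>n. (q n - q' n) / t n) \<longlongrightarrow> B) G"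
  shows "((\<lambda>n. (p n / q n - p' n / q' n) / t n) \<longlongrightarrow> (A - a / b * B) / b) G"
proof -
  have "\<forall>\<^sub>F n in G. q n \<noteq> 0" "\<forall>\<^sub>F n in G. q' n \<noteq> 0"
    using assms tendsto_imp_eventually_ne by blast+
  \<comment> \<open>Both denominators are eventually nonzero, and there
    \<open>p/q - p'/q' = ((p - p') - (p'/q') * (q - q')) / q\<close>.\<close>
  then have "\<forall>\<^sub>F n in G. ((p n - p' n) / t n - p' n / q' n * ((q n - q' n) / t n)) / q n
      = (p n / q n - p' n / q' n) / t n"
    by eventually_elim (simp add: divide_simps, simp add: algebra_simps)
  moreover have "((\<lambda>n. ((p n - p' n) / t n - p' n / q' n * ((q n - q' n) / t n)) / q n)
      \<longlongrightarrow> (A - a / b * B) / b) G"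
    using assms by (intro tendsto_intros)
  ultimately show ?thesis
    by (rule Lim_transform_eventually[rotated])
qed


section \<open>Multipliers at a Borwein properly efficient solution\<close>

theorem corollary3p1:
  fixes U :: "'z::banach set"
    and f F :: "'z \<Rightarrow> real ^ 'p"
    and m l :: nat
    and g h :: "nat \<Rightarrow> 'z \<Rightarrow> real"
    and x0 :: 'z
    and s :: "real ^ 'p"
    and df :: "'p \<Rightarrow> 'z \<Rightarrow>\<^sub>L real"
    and dF :: "'p \<Rightarrow> 'z \<Rightarrow> 'z \<Rightarrow>\<^sub>L real"
    and dg dh :: "nat \<Rightarrow> 'z \<Rightarrow>\<^sub>L real"
  defines "X \<equiv> feasible_set U m g l h"
  assumes reflexive: "reflexive_space TYPE('z)"
    and U: "open U" "U \<noteq> {}"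
    and F_pos: "\<forall>x\<in>U. \<forall>i. F x $ i > 0"
    and borwein: "borwein_properly_efficient (vec_quotient f F) X x0"
    and s: "\<forall>i. s $ i = f x0 $ i / F x0 $ i"
    and lipschitz:
      "\<forall>i. locally_lipschitz_on U (\<lambda>x. f x $ i)"
      "\<forall>i. locally_lipschitz_on U (\<lambda>x. F x $ i)"
      "\<forall>j\<in>{1..m}. locally_lipschitz_on U (g j)"
      "\<forall>k\<in>{1..l}. locally_lipschitz_on U (h k)"
    and regular:
      "\<forall>i. \<forall>x\<in>U. clarke_regular (\<lambda>x. f x $ i) x"
      "\<forall>i. \<forall>x\<in>U. clarke_regular (\<lambda>x. F x $ i) x"
      "\<forall>j\<in>{1..m}. \<forall>x\<in>U. clarke_regular (g j) x"
      "\<forall>k\<in>{1..l}. \<forall>x\<in>U. clarke_regular (h k) x"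
    and second_order_finite:
      "\<forall>i. \<forall>x\<in>U. \<forall>d. \<bar>pales_zeidan_deriv (\<lambda>x. f x $ i) x d\<bar> \<noteq> \<infinity>"
      "\<forall>j\<in>{1..m}. \<forall>x\<in>U. \<forall>d. \<bar>pales_zeidan_deriv (g j) x d\<bar> \<noteq> \<infinity>"
      "\<forall>k\<in>{1..l}. \<forall>x\<in>U. \<forall>d. \<bar>pales_zeidan_deriv (h k) x d\<bar> \<noteq> \<infinity>"
    and F_gateaux: "\<forall>i. \<forall>x\<in>U. has_gateaux_deriv (\<lambda>x. F x $ i) x (dF i x)"
    and F_second: "\<forall>i. \<forall>x\<in>U. \<forall>d. \<exists>c. has_second_dir_deriv (\<lambda>x. F x $ i) x d c"
    and gateaux_x0:
      "\<forall>i. has_gateaux_deriv (\<lambda>x. f x $ i) x0 (df i)"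
      "\<forall>j\<in>{1..m}. has_gateaux_deriv (g j) x0 (dg j)"
      "\<forall>k\<in>{1..l}. has_gateaux_deriv (h k) x0 (dh k)"
    and cq: "linearizing_cone f F m g l h x0 \<subseteq> contingent_cone X x0"
  shows "\<exists>(lam :: real ^ 'p) (\<mu> :: nat \<Rightarrow> real) (\<nu> :: nat \<Rightarrow> real).
           lam \<in> pos_orthant \<and> (\<forall>j\<in>{1..m}. 0 \<le> \<mu> j) \<and>
           (\<Sum>i\<in>UNIV. lam $ i *\<^sub>R (df i - s $ i *\<^sub>R dF i x0))
             + (\<Sum>j=1..m. \<mu> j *\<^sub>R dg j) + (\<Sum>k=1..l. \<nu> k *\<^sub>R dh k) = 0 \<and>
           (\<forall>j\<in>{1..m}. \<mu> j * g j x0 = 0)"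
proof -
  have x0X: "x0 \<in> X" and eff: "contingent_cone {vec_quotient f F x + r | x r.
      x \<in> X \<and> r \<in> nonneg_orthant} (vec_quotient f F x0) \<inter> uminus ` nonneg_orthant = {0}"
    using borwein unfolding borwein_properly_efficient_def by auto
  have XU: "X \<subseteq> U"
    by (auto simp: X_def feasible_set_def)
  with x0X have x0: "x0 \<in> U" by blast
  have F0: "F x0 $ i > 0" for i
    using F_pos x0 by blast
  \<comment> \<open>The derivative of the quotient at \<open>x0\<close> is \<open>a i\<close>
    divided by \<open>F x0 $ i\<close>. Dropping this positive factor changes neither signs nor
    zeros and gives the functionals of the conclusion.\<close>
  define a where "a i = df i - s $ i *\<^sub>R dF i x0" for i
  have a_apply: "blinfun_apply (a i) d
      = blinfun_apply (df i) d - f x0 $ i / F x0 $ i * blinfun_apply (dF i x0) d" for i d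
    using s by (simp add: a_def blinfun.diff_left blinfun.scaleR_left)

  have clarke_quotient: "clarke_deriv (\<lambda>x. vec_quotient f F x $ i) x0 d
      = ereal (blinfun_apply (a i) d / F x0 $ i)" for i d
  proof (rule clarke_deriv_strict)
    let ?G = "nhds x0 \<times>\<^sub>F at_right (0::real)"
    have base: "filterlim fst (nhds x0) ?G"
      by (rule filterlim_fst)
    have moved: "filterlim (\<lambda>p. fst p + snd p *\<^sub>R d) (nhds x0) ?G"
      using filterlim_shift_base[of d x0] by (simp add: case_prod_unfold)
    have "((\<lambda>p. (f (fst p + snd p *\<^sub>R d) $ i / F (fst p + snd p *\<^sub>R d) $ i
          - f (fst p) $ i / F (fst p) $ i) / snd p) \<longlongrightarrow> (blinfun_apply (df i) d
          - f x0 $ i / F x0 $ i * blinfun_apply (dF i x0) d) / F x0 $ i) ?G"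
    proof (rule tendsto_difference_quotient_divide)
      show "((\<lambda>p. f (fst p + snd p *\<^sub>R d) $ i) \<longlongrightarrow> f x0 $ i) ?G"
        by (rule locally_lipschitz_on_tendsto[OF lipschitz(1)[rule_format] U(1) x0 moved])
      show "((\<lambda>p. f (fst p) $ i) \<longlongrightarrow> f x0 $ i) ?G"
        by (rule locally_lipschitz_on_tendsto[OF lipschitz(1)[rule_format] U(1) x0 base])
      show "((\<lambda>p. F (fst p + snd p *\<^sub>R d) $ i) \<longlongrightarrow> F x0 $ i) ?G"
        by (rule locally_lipschitz_on_tendsto[OF lipschitz(2)[rule_format] U(1) x0 moved])
      show "((\<lambda>p. F (fst p) $ i) \<longlongrightarrow> F x0 $ i) ?G"
        by (rule locally_lipschitz_on_tendsto[OF lipschitz(2)[rule_format] U(1) x0 base])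
      show "F x0 $ i \<noteq> 0"
        using F0[of i] by simp
      show "((\<lambda>p. (f (fst p + snd p *\<^sub>R d) $ i - f (fst p) $ i) / snd p)
          \<longlongrightarrow> blinfun_apply (df i) d) ?G"
        using clarke_regular_strict_deriv[of "\<lambda>x. f x $ i" x0 "df i" d] regular(1) gateaux_x0(1) x0
        by (simp add: case_prod_unfold)
      show "((\<lambda>p. (F (fst p + snd p *\<^sub>R d) $ i - F (fst p) $ i) / snd p)
          \<longlongrightarrow> blinfun_apply (dF i x0) d) ?G"
        using clarke_regular_strict_deriv[of "\<lambda>x. F x $ i" x0 "dF i x0" d] regular(2) F_gateaux x0
        by (simp add: case_prod_unfold)
    qed
    then show "((\<lambda>(y, t). (vec_quotient f F (y + t *\<^sub>R d) $ i - vec_quotient f F y $ i) / t)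
        \<longlongrightarrow> blinfun_apply (a i) d / F x0 $ i) ?G"
      by (simp add: case_prod_unfold vec_quotient_def a_apply)
  qed

  have clarke_g: "clarke_deriv (g j) x0 d = ereal (blinfun_apply (dg j) d)" if "j \<in> {1..m}" for j d
    using clarke_deriv_gateaux that regular(3) gateaux_x0(2) x0 by blast
  have clarke_h: "clarke_deriv (h k) x0 d = ereal (blinfun_apply (dh k) d)" if "k \<in> {1..l}" for k d
    using clarke_deriv_gateaux that regular(4) gateaux_x0(3) x0 by blast

  let ?J = "active_set m g x0"
  have J: "?J \<subseteq> {1..m}" by (auto simp: active_set_def)
  \<comment> \<open>This is the hypothesis \<open>zero\<close> of \<open>tucker_alternative\<close>,
    and the only place where efficiency and the constraint qualification enter.\<close>
  have stationary: "blinfun_apply (a i) d = 0"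
    if a_le: "\<And>i. blinfun_apply (a i) d \<le> 0"
      and g_le: "\<And>j. j \<in> ?J \<Longrightarrow> blinfun_apply (dg j) d \<le> 0"
      and h_eq: "\<And>k. k \<in> {1..l} \<Longrightarrow> blinfun_apply (dh k) d = 0" for i d
  proof -
    have "d \<in> linearizing_cone f F m g l h x0"
      using a_le g_le h_eq J F0 clarke_g clarke_h
      by (auto simp: linearizing_cone_def clarke_quotient divide_le_0_iff less_imp_le subset_iff
          zero_ereal_def)
    then obtain t e where t: "\<And>k. 0 < t k" "t \<longlonglongrightarrow> 0" and e: "e \<longlonglongrightarrow> d"
      and inX: "\<And>k. x0 + t k *\<^sub>R e k \<in> X"
      using cq unfolding contingent_cone_def by blast
    \<comment> \<open>The vectors \<open>w k\<close> are the difference quotients of f/F along the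
      feasible sequence, and \<open>D\<close> is their limit. Moving from the image of
      \<open>x0\<close> by \<open>t k *\<^sub>R w k\<close> lands exactly on the image of a feasible
      point, so the orthant summand can be taken to be 0.\<close>
    define w where "w k = (1 / t k) *\<^sub>R
      (vec_quotient f F (x0 + t k *\<^sub>R e k) - vec_quotient f F x0)" for k
    define D where "D = (\<chi> i. blinfun_apply (a i) d / F x0 $ i)"
    have "(\<lambda>k. x0 + t k *\<^sub>R e k) \<longlonglongrightarrow> x0 + 0 *\<^sub>R d"
      using t e by (intro tendsto_intros)
    then have conv: "(\<lambda>k. x0 + t k *\<^sub>R e k) \<longlonglongrightarrow> x0" by simp
    have "w \<longlonglongrightarrow> D"
    proof (rule vec_tendstoI)
      fix i
      have "(\<lambda>k. (f (x0 + t k *\<^sub>R e k) $ i / F (x0 + t k *\<^sub>R e k) $ i - f x0 $ i / F x0 $ i) / t k)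
        \<longlonglongrightarrow> (blinfun_apply (df i) d - f x0 $ i / F x0 $ i * blinfun_apply (dF i x0) d) / F x0 $ i"
      proof (rule tendsto_difference_quotient_divide)
        show "(\<lambda>k. f (x0 + t k *\<^sub>R e k) $ i) \<longlonglongrightarrow> f x0 $ i"
          by (rule locally_lipschitz_on_tendsto[OF lipschitz(1)[rule_format] U(1) x0 conv])
        show "(\<lambda>k. F (x0 + t k *\<^sub>R e k) $ i) \<longlonglongrightarrow> F x0 $ i"
          by (rule locally_lipschitz_on_tendsto[OF lipschitz(2)[rule_format] U(1) x0 conv])
        show "F x0 $ i \<noteq> 0"
          using F0[of i] by simp
        show "(\<lambda>k. (f (x0 + t k *\<^sub>R e k) $ i - f x0 $ i) / t k) \<longlonglongrightarrow> blinfun_apply (df i) d"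
          using gateaux_x0(1) unfolding has_gateaux_deriv_def
          by (intro locally_lipschitz_on_hadamard_deriv[OF lipschitz(1)[rule_format] U(1) x0 _ t e]) auto
        show "(\<lambda>k. (F (x0 + t k *\<^sub>R e k) $ i - F x0 $ i) / t k) \<longlonglongrightarrow> blinfun_apply (dF i x0) d"
          using F_gateaux x0 unfolding has_gateaux_deriv_def
          by (intro locally_lipschitz_on_hadamard_deriv[OF lipschitz(2)[rule_format] U(1) x0 _ t e]) auto
      qed auto
      then show "(\<lambda>k. w k $ i) \<longlonglongrightarrow> D $ i"
        by (simp add: w_def D_def vec_quotient_def a_apply)
    qed
    moreover have "vec_quotient f F x0 + t k *\<^sub>R w k \<in>
        {vec_quotient f F x + r | x r. x \<in> X \<and> r \<in> nonneg_orthant}" for k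
    proof -
      have "vec_quotient f F x0 + t k *\<^sub>R w k = vec_quotient f F (x0 + t k *\<^sub>R e k) + 0"
        using t(1)[of k] by (simp add: w_def)
      moreover have "(0 :: real ^ 'p) \<in> nonneg_orthant" by (simp add: nonneg_orthant_def)
      ultimately show ?thesis using inX[of k] by blast
    qed
    ultimately have "D \<in> contingent_cone {vec_quotient f F x + r | x r.
        x \<in> X \<and> r \<in> nonneg_orthant} (vec_quotient f F x0)"
      using t unfolding contingent_cone_def by blast
    \<comment> \<open>The components of \<open>D\<close> have the signs of the \<open>a i\<close> at
      \<open>d\<close>, so Borwein efficiency leaves only \<open>D = 0\<close>.\<close>
    moreover have "D \<in> uminus ` nonneg_orthant"
    proof (rule image_eqI)
      show "D = - (- D)" by simp
      show "- D \<in> nonneg_orthant"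
        using a_le F0 by (simp add: nonneg_orthant_def D_def divide_le_0_iff less_imp_le)
    qed
    ultimately have "D = 0" using eff by blast
    then have "D $ i = 0" by simp
    then show ?thesis using F0[of i] by (simp add: D_def)
  qed

  have lin: "linear (blinfun_apply \<phi>)" for \<phi> :: "'z \<Rightarrow>\<^sub>L real"
    using blinfun.bounded_linear_right bounded_linear.linear by blast
  have "\<exists>c u v. (\<forall>i\<in>(UNIV :: 'p set). 0 < c i) \<and> (\<forall>j\<in>?J. 0 \<le> u j) \<and>
      (\<forall>d. (\<Sum>i\<in>UNIV. c i * blinfun_apply (a i) d) + (\<Sum>j\<in>?J. u j * blinfun_apply (dg j) d)
        + (\<Sum>k\<in>{1..l}. v k * blinfun_apply (dh k) d) = 0)"
    using lin stationary finite_subset[OF J] by (intro tucker_alternative) auto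
  then obtain c u v where c: "\<forall>i\<in>(UNIV :: 'p set). 0 < c i" and u: "\<forall>j\<in>?J. 0 \<le> u j"
    and comb: "\<forall>d. (\<Sum>i\<in>UNIV. c i * blinfun_apply (a i) d)
        + (\<Sum>j\<in>?J. u j * blinfun_apply (dg j) d) + (\<Sum>k\<in>{1..l}. v k * blinfun_apply (dh k) d) = 0"
    by blast
  \<comment> \<open>Extension by 0 to the inactive constraints yields complementary slackness:
    either the multiplier or the constraint value at \<open>x0\<close> is zero.\<close>
  define \<mu> where "\<mu> j = (if j \<in> ?J then u j else 0)" for j
  have \<mu>: "(\<Sum>j=1..m. \<mu> j * blinfun_apply (dg j) d) = (\<Sum>j\<in>?J. u j * blinfun_apply (dg j) d)" for d
    using J by (intro sum.mono_neutral_cong_right) (auto simp: \<mu>_def)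
  \<comment> \<open>The identity \<open>comb\<close>, valid at every \<open>d\<close>, becomes an
    equation in the dual space.\<close>
  have "(\<Sum>i\<in>UNIV. (\<chi> i. c i) $ i *\<^sub>R (df i - s $ i *\<^sub>R dF i x0))
      + (\<Sum>j=1..m. \<mu> j *\<^sub>R dg j) + (\<Sum>k=1..l. v k *\<^sub>R dh k) = 0"
    using comb unfolding a_def[symmetric]
    by (intro blinfun_eqI) (simp add: blinfun.add_left blinfun.sum_left blinfun.scaleR_left \<mu> del: One_nat_def)
  moreover have "\<forall>j\<in>{1..m}. \<mu> j * g j x0 = 0"
    by (auto simp: \<mu>_def active_set_def)
  ultimately show ?thesis
    using c u by (intro exI[of _ "\<chi> i. c i"] exI[of _ \<mu>] exI[of _ v])
      (auto simp: pos_orthant_def \<mu>_def)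
qed

end
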